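(* Let $\alpha,\beta\in\,]0,1[$ and $M>0$ be fixed. For all integers $n,d\ge1$, the test $$\Psi_{1,\alpha}=\mathbf{1}_{\{\|\sqrt n\,\bar X_n\|^2>\upsilon_\alpha\}}$$ is of level $\alpha$, where $\bar X_n=\frac1n\sum_{i=1}^nX_i$ and $\upsilon_\alpha$ is the $(1-\alpha)$-quantile of the chi-squared distribution with $d$ degrees of freedom. Moreover, there exists a positive constant $C(\alpha,\beta,M)$ depending only on $\alpha$, $\beta$ and $M$ (not on $n$ or $d$) such that, for all $n,d\ge1$, $$\sup_{f_{(\varepsilon,\mu)}\in\mathcal F_2[M],\ \varepsilon\|\mu\|\ge\rho}\ \mathbb{P}_{f_{(\varepsilon,\mu)}}(\Psi_{1,\alpha}=0)\le\beta$$ for all $\rho>0$ such that $$\rho\ge C(\alpha,\beta,M)\,\frac{d^{1/4}}{\sqrt n}.$$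
   Context: Let $\phi_d$ be the density of the standard Gaussian distribution $\mathcal N_d(0_d,I_d)$ on $\mathbb{R}^d$. For $\varepsilon\in\,]0,1[$ and $\mu\in\mathbb{R}^d$ put $f_{(\varepsilon,\mu)}(x)=(1-\varepsilon)\phi_d(x)+\varepsilon\phi_d(x-\mu)$. Let $\|\cdot\|$ be the Euclidean norm and $\mathcal F_2[M]=\{f_{(\varepsilon,\mu)}:\varepsilon\in\,]0,1[,\ \|\mu\|\le M\}$. One observes an i.i.d. sample $(X_1,\dots,X_n)$ of $\mathbb{R}^d$-valued vectors. For a density $g$ on $\mathbb{R}^d$, $\mathbb{P}_g$ is the probability when the common density of the $X_i$ is $g$; $\mathbb{P}_0:=\mathbb{P}_{\phi_d}$. A test $\Psi$ (a measurable $\{0,1\}$-valued function of the sample) has level $\alpha$ if $\mathbb{P}_0(\Psi=1)\le\alpha$. A supremum over an empty set is $0$. *)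

theory Defs
  imports "HOL-Probability.Probability"
begin

(* R^d is the set of extensional functions on {..<d} (the space of the product measure below), since
   the constant C in the result must not depend on d and so d cannot be a type parameter.
   The Euclidean norm of x is L2_set x {..<d}. A sample is X with X i in R^d for i < n. *)

abbreviation RR :: "nat \<Rightarrow> (nat \<Rightarrow> real) set" where
  "RR d \<equiv> {..<d} \<rightarrow>\<^sub>E UNIV"

definition lebesgue_RR :: "nat \<Rightarrow> (nat \<Rightarrow> real) measure" where
  "lebesgue_RR d = PiM {..<d} (\<lambda>_. lborel)"

definition gauss_density :: "nat \<Rightarrow> (nat \<Rightarrow> real) \<Rightarrow> real" where
  "gauss_density d x = (2 * pi) powr (- (real d / 2)) * exp (- ((L2_set x {..<d})\<^sup>2 / 2))"

definition mix_density :: "nat \<Rightarrow> real \<Rightarrow> (nat \<Rightarrow> real) \<Rightarrow> (nat \<Rightarrow> real) \<Rightarrow> real" where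
  "mix_density d \<epsilon> \<mu> x =
     (1 - \<epsilon>) * gauss_density d x + \<epsilon> * gauss_density d (\<lambda>j\<in>{..<d}. x j - \<mu> j)"

definition sample_law ::
    "nat \<Rightarrow> nat \<Rightarrow> ((nat \<Rightarrow> real) \<Rightarrow> real) \<Rightarrow> (nat \<Rightarrow> nat \<Rightarrow> real) measure" where
  "sample_law n d g = PiM {..<n} (\<lambda>_. density (lebesgue_RR d) (\<lambda>x. ennreal (g x)))"

definition sample_prob ::
    "nat \<Rightarrow> nat \<Rightarrow> ((nat \<Rightarrow> real) \<Rightarrow> real) \<Rightarrow> ((nat \<Rightarrow> nat \<Rightarrow> real) \<Rightarrow> bool) \<Rightarrow> real" where
  "sample_prob n d g A = measure (sample_law n d g) {X \<in> space (sample_law n d g). A X}"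

definition is_test :: "nat \<Rightarrow> nat \<Rightarrow> ((nat \<Rightarrow> nat \<Rightarrow> real) \<Rightarrow> nat) \<Rightarrow> bool" where
  "is_test n d \<Psi> \<longleftrightarrow>
     \<Psi> \<in> measurable (PiM {..<n} (\<lambda>_. PiM {..<d} (\<lambda>_. borel))) (count_space {0, 1})"

definition has_level :: "nat \<Rightarrow> nat \<Rightarrow> real \<Rightarrow> ((nat \<Rightarrow> nat \<Rightarrow> real) \<Rightarrow> nat) \<Rightarrow> bool" where
  "has_level n d \<alpha> \<Psi> \<longleftrightarrow>
     is_test n d \<Psi> \<and> sample_prob n d (gauss_density d) (\<lambda>X. \<Psi> X = 1) \<le> \<alpha>"

(* The law of the sum of squares of d independent standard normal variables. *)
definition chi_squared :: "nat \<Rightarrow> real measure" where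
  "chi_squared d =
     distr (PiM {..<d} (\<lambda>_. density lborel (\<lambda>t. ennreal (std_normal_density t)))) borel
       (\<lambda>x. \<Sum>j<d. (x j)\<^sup>2)"

definition quantile :: "real measure \<Rightarrow> real \<Rightarrow> real" where
  "quantile N p = Inf {t. p \<le> cdf N t}"

definition sample_mean :: "nat \<Rightarrow> nat \<Rightarrow> (nat \<Rightarrow> nat \<Rightarrow> real) \<Rightarrow> (nat \<Rightarrow> real)" where
  "sample_mean n d X = (\<lambda>j\<in>{..<d}. (1 / real n) * (\<Sum>i<n. X i j))"

definition Psi1 :: "nat \<Rightarrow> nat \<Rightarrow> real \<Rightarrow> (nat \<Rightarrow> nat \<Rightarrow> real) \<Rightarrow> nat" where
  "Psi1 n d \<alpha> X =
     (if (L2_set (\<lambda>j\<in>{..<d}. sqrt (real n) * sample_mean n d X j) {..<d})\<^sup>2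
           > quantile (chi_squared d) (1 - \<alpha>)
      then 1 else 0)"

(* The class is represented by its parameters: constraints such as \<epsilon> * norm \<mu> \<ge> \<rho> refer to them,
   not to the density. *)
definition F2_params :: "nat \<Rightarrow> real \<Rightarrow> (real \<times> (nat \<Rightarrow> real)) set" where
  "F2_params d M = {(\<epsilon>, \<mu>). 0 < \<epsilon> \<and> \<epsilon> < 1 \<and> \<mu> \<in> RR d \<and> L2_set \<mu> {..<d} \<le> M}"

(* Supremum with value 0 on the empty set; Sup {} is unspecified on the reals. *)
definition sup0 :: "real set \<Rightarrow> real" where
  "sup0 S = (if S = {} then 0 else Sup S)"

end

theory Submission
  imports Defs
begin

text \<open>
An observation from the mixture is \<open>Z\<^sub>i + B\<^sub>i \<mu>\<close> with \<open>Z\<^sub>i\<close> standard Gaussian and \<open>B\<^sub>i\<close> an independent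
Bernoulli variable of parameter \<open>\<epsilon>\<close>. The test depends on the sample only through its sum, and the sum
divided by \<open>\<surd>n\<close> is distributed as \<open>Z + (K / \<surd>n) \<mu>\<close>, with \<open>Z\<close> standard Gaussian and \<open>K\<close> an
independent binomial variable of parameters \<open>n\<close> and \<open>\<epsilon>\<close> (\<open>nn_integral_sum_mix_law\<close>). The sample
therefore disappears from the problem, and the statistic is
\<open>\<parallel>Z\<parallel>\<^sup>2 + 2 (K / \<surd>n) \<langle>Z, \<mu>\<rangle> + W\<^sup>2\<close> with \<open>W = K \<parallel>\<mu>\<parallel> / \<surd>n\<close>.

With no signal this is \<open>\<parallel>Z\<parallel>\<^sup>2\<close>, whose law is chi-squared, and a distribution function
reaches the level of its quantile by right continuity; so the test has level \<open>\<alpha>\<close>.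

Under the alternative it is enough to use Chebyshev's inequality, with \<open>\<delta> = \<beta> / 3\<close>, three times. Outside
events of probability at most \<open>\<delta>\<close> each, \<open>\<parallel>Z\<parallel>\<^sup>2\<close> is within \<open>\<surd>(2 d / \<delta>)\<close> of \<open>d\<close>, the inner product
\<open>\<langle>Z, \<mu>\<rangle>\<close> is at most \<open>\<parallel>\<mu>\<parallel> / \<surd>\<delta>\<close> in absolute value, and \<open>K\<close> is at least \<open>n \<epsilon> / 2\<close>. The last one
requires \<open>n \<epsilon>\<close> to be large, which follows from \<open>\<parallel>\<mu>\<parallel> \<le> M\<close> and from the separation condition. Then
\<open>W\<close> is at least half of \<open>\<surd>n \<epsilon> \<parallel>\<mu>\<parallel>\<close>, hence at least \<open>C / 2\<close> times the fourth root of \<open>d\<close>. The critical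
value is at most \<open>d + \<surd>(2 d / \<alpha>)\<close>, again by Chebyshev's inequality, and for large \<open>C\<close> the term \<open>W\<^sup>2\<close>
exceeds the sum of the cross term and of the two deviations of order \<open>\<surd>d\<close>. All bounds are uniform in
\<open>n\<close> and \<open>d\<close>.
\<close>

section \<open>The standard Gaussian law and its translates\<close>

abbreviation stdN :: "real measure" where
  "stdN \<equiv> std_normal_distribution"

text \<open>The law \<open>N(0, I\<^sub>d)\<close> is kept as a product measure, so that independence of the
coordinates is available as Fubini's theorem; \<open>density_gauss_density\<close> identifies it with the
law of density \<^const>\<open>gauss_density\<close>.\<close>

definition gauss :: "nat \<Rightarrow> (nat \<Rightarrow> real) measure" where
  "gauss d = PiM {..<d} (\<lambda>_. stdN)"

lemma prob_space_stdN: "prob_space stdN"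
  by (simp add: prob_space_normal_density)

interpretation stdN: prob_space stdN
  by (rule prob_space_stdN)

interpretation stdN_product: product_prob_space "\<lambda>_. stdN" I for I :: "nat set"
  by unfold_locales

lemma prob_space_gauss: "prob_space (gauss d)"
  unfolding gauss_def by (intro prob_space_PiM prob_space_stdN)

lemma sets_gauss[measurable_cong]: "sets (gauss d) = sets (PiM {..<d} (\<lambda>_. borel))"
  unfolding gauss_def by (intro sets_PiM_cong) auto

lemma space_gauss: "space (gauss d) = RR d"
  unfolding gauss_def by (simp add: space_PiM)

text \<open>Both sides agree on boxes, where the integral of a product of functions of separate coordinates
factorizes.\<close>

lemma PiM_density:
  fixes f :: "'i \<Rightarrow> 'a \<Rightarrow> ennreal"
  assumes "finite I" and "product_sigma_finite M"
    and [measurable]: "\<And>i. f i \<in> borel_measurable (M i)"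
    and "product_sigma_finite (\<lambda>i. density (M i) (f i))"
  shows "PiM I (\<lambda>i. density (M i) (f i)) = density (PiM I M) (\<lambda>x. \<Prod>i\<in>I. f i (x i))"
proof -
  interpret M: product_sigma_finite M by fact
  interpret D: product_sigma_finite "\<lambda>i. density (M i) (f i)" by fact
  show ?thesis
  proof (rule D.PiM_eqI[OF \<open>finite I\<close>, symmetric])
    show "sets (density (PiM I M) (\<lambda>x. \<Prod>i\<in>I. f i (x i))) =
        sets (PiM I (\<lambda>i. density (M i) (f i)))"
      unfolding sets_density by (intro sets_PiM_cong) auto
  next
    fix A assume "\<And>i. i \<in> I \<Longrightarrow> A i \<in> sets (density (M i) (f i))"
    then have A[measurable]: "A i \<in> sets (M i)" if "i \<in> I" for i
      using that by simp
    have "emeasure (density (PiM I M) (\<lambda>x. \<Prod>i\<in>I. f i (x i))) (Pi\<^sub>E I A)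
        = (\<integral>\<^sup>+x. (\<Prod>i\<in>I. f i (x i)) * indicator (Pi\<^sub>E I A) x \<partial>PiM I M)"
      using A assms(1) by (intro emeasure_density) (auto intro!: sets_PiM_I_finite)
    also have "\<dots> = (\<integral>\<^sup>+x. (\<Prod>i\<in>I. f i (x i) * indicator (A i) (x i)) \<partial>PiM I M)"
    proof (rule nn_integral_cong)
      fix x assume "x \<in> space (PiM I M)"
      then have "x \<in> extensional I" by (simp add: space_PiM PiE_def)
      then have "(indicator (Pi\<^sub>E I A) x :: ennreal) = (\<Prod>i\<in>I. indicator (A i) (x i))"
        using assms(1) by (auto simp: indicator_def PiE_def Pi_iff prod_zero_iff
            intro!: prod.neutral split: if_splits)
      then show "(\<Prod>i\<in>I. f i (x i)) * indicator (Pi\<^sub>E I A) x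
          = (\<Prod>i\<in>I. f i (x i) * indicator (A i) (x i))"
        by (simp add: prod.distrib)
    qed
    also have "\<dots> = (\<Prod>i\<in>I. \<integral>\<^sup>+x. f i x * indicator (A i) x \<partial>M i)"
      using assms(1) by (intro M.product_nn_integral_prod) auto
    also have "\<dots> = (\<Prod>i\<in>I. emeasure (density (M i) (f i)) (A i))"
      by (intro prod.cong refl emeasure_density[symmetric]) auto
    finally show "emeasure (density (PiM I M) (\<lambda>x. \<Prod>i\<in>I. f i (x i))) (Pi\<^sub>E I A)
        = (\<Prod>i\<in>I. emeasure (density (M i) (f i)) (A i))" .
  qed
qed

lemma distr_stdN_affine:
  assumes "s \<noteq> 0"
  shows "distr stdN borel (\<lambda>x. m + s * x) = density lborel (\<lambda>t. ennreal (normal_density m \<bar>s\<bar> t))"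
proof -
  have "distributed stdN lborel (\<lambda>x. x) (normal_density 0 1)"
    unfolding distributed_def by (auto simp: distr_id2)
  from stdN.normal_density_affine[OF this, of s m] assms
  have "distr stdN lborel (\<lambda>x. m + s * x) = density lborel (\<lambda>t. ennreal (normal_density m \<bar>s\<bar> t))"
    by (simp add: distributed_def)
  then show ?thesis
    by (simp cong: distr_cong)
qed

lemma prod_normal_density:
  "(\<Prod>j<d. normal_density (\<mu> j) 1 (x j)) = gauss_density d (\<lambda>j\<in>{..<d}. x j - \<mu> j)"
proof -
  have "(\<Prod>j<d. normal_density (\<mu> j) 1 (x j))
      = (1 / sqrt (2 * pi)) ^ d * exp (\<Sum>j<d. - (x j - \<mu> j)\<^sup>2 / 2)"
    by (simp add: normal_density_def prod_dividef exp_sum power_divide)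
  also have "(1 / sqrt (2 * pi)) ^ d = (2 * pi) powr (- (real d / 2))"
    by (simp add: powr_half_sqrt[symmetric] powr_minus_divide[symmetric] powr_powr
        flip: powr_realpow)
  also have "(\<Sum>j<d. - (x j - \<mu> j)\<^sup>2 / 2) = - ((L2_set (\<lambda>j\<in>{..<d}. x j - \<mu> j) {..<d})\<^sup>2 / 2)"
    by (simp add: L2_set_def sum_nonneg sum_negf flip: sum_divide_distrib)
  finally show ?thesis
    by (simp add: gauss_density_def)
qed

text \<open>A translated Gaussian density factorizes into the normal densities with means \<open>\<mu> j\<close>, and each
factor is the law of a translated standard normal variable. The alternative can thus be read as
standard Gaussian noise, shifted by \<open>\<mu>\<close> with probability \<open>\<epsilon>\<close>.\<close>

lemma density_gauss_shift:
  "density (lebesgue_RR d) (\<lambda>x. ennreal (gauss_density d (\<lambda>j\<in>{..<d}. x j - \<mu> j)))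
     = distr (gauss d) (gauss d) (\<lambda>z. \<lambda>j\<in>{..<d}. z j + \<mu> j)"
proof -
  interpret S: product_prob_space "\<lambda>j. density lborel (\<lambda>t. ennreal (normal_density (\<mu> j) 1 t))" UNIV
    by (intro product_prob_spaceI prob_space_normal_density) simp
  have "density (lebesgue_RR d) (\<lambda>x. ennreal (gauss_density d (\<lambda>j\<in>{..<d}. x j - \<mu> j)))
      = density (PiM {..<d} (\<lambda>_. lborel)) (\<lambda>x. \<Prod>j<d. ennreal (normal_density (\<mu> j) 1 (x j)))"
    by (simp add: lebesgue_RR_def prod_ennreal flip: prod_normal_density)
  also have "\<dots> = PiM {..<d} (\<lambda>j. density lborel (\<lambda>t. ennreal (normal_density (\<mu> j) 1 t)))"
    by (rule PiM_density[symmetric])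
      (auto simp: product_sigma_finite_def prob_space_imp_sigma_finite prob_space_normal_density
        lborel.sigma_finite_measure_axioms)
  also have "\<dots> = distr (gauss d) (gauss d) (\<lambda>z. \<lambda>j\<in>{..<d}. z j + \<mu> j)"
  proof (rule S.PiM_eqI[symmetric])
    show "sets (distr (gauss d) (gauss d) (\<lambda>z. \<lambda>j\<in>{..<d}. z j + \<mu> j)) =
        sets (PiM {..<d} (\<lambda>j. density lborel (\<lambda>t. ennreal (normal_density (\<mu> j) 1 t))))"
      unfolding sets_distr gauss_def by (intro sets_PiM_cong) auto
  next
    fix A assume "\<And>j. j \<in> {..<d} \<Longrightarrow> A j \<in> sets (density lborel (\<lambda>t. ennreal (normal_density (\<mu> j) 1 t)))"
    then have A[measurable]: "A j \<in> sets borel" if "j \<in> {..<d}" for j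
      using that by simp
    have "emeasure (distr (gauss d) (gauss d) (\<lambda>z. \<lambda>j\<in>{..<d}. z j + \<mu> j)) (Pi\<^sub>E {..<d} A)
       = emeasure (gauss d) ((\<lambda>z. \<lambda>j\<in>{..<d}. z j + \<mu> j) -` (Pi\<^sub>E {..<d} A) \<inter> space (gauss d))"
      by (intro emeasure_distr) (auto simp: sets_gauss intro!: sets_PiM_I_finite)
    also have "(\<lambda>z. \<lambda>j\<in>{..<d}. z j + \<mu> j) -` (Pi\<^sub>E {..<d} A) \<inter> space (gauss d)
       = Pi\<^sub>E {..<d} (\<lambda>j. (\<lambda>t. \<mu> j + 1 * t) -` A j)"
      by (auto simp: space_gauss PiE_iff add.commute)
    also have "emeasure (gauss d) \<dots> = (\<Prod>j<d. emeasure stdN ((\<lambda>t. \<mu> j + 1 * t) -` A j))"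
      unfolding gauss_def by (intro stdN_product.emeasure_PiM) (auto intro!: measurable_sets_borel[where M=borel])
    also have "\<dots> = (\<Prod>j<d. emeasure (distr stdN borel (\<lambda>x. \<mu> j + 1 * x)) (A j))"
      by (intro prod.cong refl) (simp add: emeasure_distr)
    also have "\<dots> = (\<Prod>j<d. emeasure (density lborel (\<lambda>t. ennreal (normal_density (\<mu> j) 1 t))) (A j))"
      by (subst distr_stdN_affine) auto
    finally show "emeasure (distr (gauss d) (gauss d) (\<lambda>z. \<lambda>j\<in>{..<d}. z j + \<mu> j)) (Pi\<^sub>E {..<d} A)
       = (\<Prod>j<d. emeasure (density lborel (\<lambda>t. ennreal (normal_density (\<mu> j) 1 t))) (A j))" .
  qed simp
  finally show ?thesis .
qed

section \<open>Sums of Gaussian vectors\<close>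

lemma stdN_convolution:
  assumes [measurable]: "A \<in> sets borel" and "0 \<le> a"
  shows "(\<integral>\<^sup>+x. \<integral>\<^sup>+y. indicator A (a * x + y) \<partial>stdN \<partial>stdN)
    = (\<integral>\<^sup>+x. (indicator A (sqrt (a\<^sup>2 + 1) * x)::ennreal) \<partial>stdN)"
proof (cases "a = 0")
  case True
  have "emeasure stdN UNIV = 1"
    using stdN.emeasure_space_1 by simp
  then show ?thesis
    using True by simp
next
  case False
  then have "0 < a"
    using assms(2) by simp
  have fin: "finite_measure (density lborel (\<lambda>t. ennreal (normal_density 0 s t)))" if "0 < s" for s
    using that by (intro prob_space.finite_measure prob_space_normal_density)
  have "distr stdN borel (\<lambda>x. 0 + a * x) \<star> stdN
     = density lborel (\<lambda>t. ennreal (normal_density 0 (sqrt (a\<^sup>2 + 1)) t))"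
    using conv_normal_density_zero_mean[OF \<open>0 < a\<close>, of 1] \<open>0 < a\<close>
    by (subst distr_stdN_affine)
      (auto simp: convolution_density fin fun_eq_iff ennreal_mult'[symmetric])
  also have "\<dots> = distr stdN borel (\<lambda>x. 0 + sqrt (a\<^sup>2 + 1) * x)"
    by (subst distr_stdN_affine) (auto simp: add_nonneg_eq_0_iff)
  finally have D: "distr stdN borel (\<lambda>x. a * x) \<star> stdN = distr stdN borel (\<lambda>x. sqrt (a\<^sup>2 + 1) * x)"
    by simp
  have "(\<integral>\<^sup>+x. \<integral>\<^sup>+y. indicator A (a * x + y) \<partial>stdN \<partial>stdN)
      = (\<integral>\<^sup>+t. (indicator A t :: ennreal) \<partial>(distr stdN borel (\<lambda>x. a * x) \<star> stdN))"
    by (subst nn_integral_convolution)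
      (auto simp: nn_integral_distr stdN.finite_measure_axioms intro!: stdN.finite_measure_distr)
  also have "\<dots> = (\<integral>\<^sup>+x. (indicator A (sqrt (a\<^sup>2 + 1) * x)::ennreal) \<partial>stdN)"
    unfolding D by (subst nn_integral_distr) auto
  finally show ?thesis .
qed

text \<open>In every coordinate this is the one-dimensional convolution of normal laws. On a box both
integrals factorize over the coordinates, and boxes determine the measure, so the identity in one
dimension gives the one in dimension \<open>d\<close>.\<close>

lemma gauss_convolution:
  assumes f: "f \<in> borel_measurable (PiM {..<d} (\<lambda>_. borel))" and "0 \<le> a"
  shows "(\<integral>\<^sup>+z. \<integral>\<^sup>+y. f (\<lambda>j\<in>{..<d}. a * z j + y j) \<partial>gauss d \<partial>gauss d)
    = (\<integral>\<^sup>+z. f (\<lambda>j\<in>{..<d}. sqrt (a\<^sup>2 + 1) * z j) \<partial>gauss d)"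
proof -
  let ?B = "PiM {..<d} (\<lambda>_. borel) :: (nat \<Rightarrow> real) measure"
  let ?s = "sqrt (a\<^sup>2 + 1)"
  interpret G: prob_space "gauss d"
    by (rule prob_space_gauss)
  interpret N: product_prob_space "\<lambda>_. distr stdN borel (\<lambda>x. ?s * x)" UNIV
    by (intro product_prob_spaceI stdN.prob_space_distr) simp
  define L where "L = distr (gauss d \<Otimes>\<^sub>M gauss d) ?B (\<lambda>(z, y). \<lambda>j\<in>{..<d}. a * z j + y j)"
  define R where "R = distr (gauss d) ?B (\<lambda>z. \<lambda>j\<in>{..<d}. ?s * z j)"
  let ?P = "PiM {..<d} (\<lambda>_. distr stdN borel (\<lambda>x. ?s * x))"
  note [measurable_cong] = sets_gauss
  have rect: "indicator (Pi\<^sub>E {..<d} A) (\<lambda>j\<in>{..<d}. v j) = (\<Prod>j<d. indicator (A j) (v j) :: ennreal)"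
    for A and v :: "nat \<Rightarrow> real"
    by (auto simp: indicator_def PiE_iff prod_zero_iff split: if_splits)
  have "L = ?P"
  proof (rule N.PiM_eqI)
    show "sets L = sets ?P"
      unfolding L_def sets_distr by (intro sets_PiM_cong) auto
  next
    fix A assume "\<And>j. j \<in> {..<d} \<Longrightarrow> A j \<in> sets (distr stdN borel (\<lambda>x. ?s * x))"
    then have A[measurable]: "A j \<in> sets borel" if "j \<in> {..<d}" for j
      using that by simp
    then have rectm[measurable]: "Pi\<^sub>E {..<d} A \<in> sets ?B"
      by (intro sets_PiM_I_finite) auto
    have "emeasure L (Pi\<^sub>E {..<d} A) = (\<integral>\<^sup>+v. indicator (Pi\<^sub>E {..<d} A) v \<partial>L)"
      by (subst nn_integral_indicator) (auto simp: L_def)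
    also have "\<dots> = (\<integral>\<^sup>+z. \<integral>\<^sup>+y. indicator (Pi\<^sub>E {..<d} A) (\<lambda>j\<in>{..<d}. a * z j + y j) \<partial>gauss d \<partial>gauss d)"
      unfolding L_def by (subst nn_integral_distr) (auto simp: G.nn_integral_fst[symmetric])
    also have "\<dots> = (\<integral>\<^sup>+z. \<integral>\<^sup>+y. (\<Prod>j<d. indicator (A j) (a * z j + y j)) \<partial>gauss d \<partial>gauss d)"
      by (simp only: rect)
    also have "\<dots> = (\<integral>\<^sup>+z. (\<Prod>j<d. \<integral>\<^sup>+t. indicator (A j) (a * z j + t) \<partial>stdN) \<partial>gauss d)"
      unfolding gauss_def by (intro nn_integral_cong stdN_product.product_nn_integral_prod) auto
    also have "\<dots> = (\<Prod>j<d. \<integral>\<^sup>+x. \<integral>\<^sup>+t. indicator (A j) (a * x + t) \<partial>stdN \<partial>stdN)"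
      unfolding gauss_def by (intro stdN_product.product_nn_integral_prod) auto
    also have "\<dots> = (\<Prod>j<d. emeasure (distr stdN borel (\<lambda>x. ?s * x)) (A j))"
      using assms(2) by (intro prod.cong refl)
        (auto simp: stdN_convolution nn_integral_distr simp flip: nn_integral_indicator)
    finally show "emeasure L (Pi\<^sub>E {..<d} A) = (\<Prod>j<d. emeasure (distr stdN borel (\<lambda>x. ?s * x)) (A j))" .
  qed simp
  also have "?P = R"
  proof -
    have "?P = PiM {..<d} (\<lambda>_. distr stdN stdN (\<lambda>x. ?s * x))"
      by (intro PiM_cong distr_cong) auto
    also have "\<dots> = distr (gauss d) (gauss d) (compose {..<d} (\<lambda>x. ?s * x))"
      unfolding gauss_def
      by (intro distr_PiM_finite_prob_space'[symmetric]) (auto simp: prob_space_stdN)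
    also have "\<dots> = R"
      unfolding R_def by (intro distr_cong) (auto simp: compose_def sets_gauss)
    finally show ?thesis .
  qed
  finally have "L = R" .
  have "(\<integral>\<^sup>+z. \<integral>\<^sup>+y. f (\<lambda>j\<in>{..<d}. a * z j + y j) \<partial>gauss d \<partial>gauss d) = (\<integral>\<^sup>+v. f v \<partial>L)"
    unfolding L_def using f by (subst nn_integral_distr) (auto simp: G.nn_integral_fst[symmetric])
  also have "\<dots> = (\<integral>\<^sup>+z. f (\<lambda>j\<in>{..<d}. ?s * z j) \<partial>gauss d)"
    unfolding \<open>L = R\<close> R_def using f by (subst nn_integral_distr) auto
  finally show ?thesis .
qed

section \<open>The sum of a sample from a Gaussian mixture\<close>

lemma sets_lebesgue_RR: "sets (lebesgue_RR d) = sets (PiM {..<d} (\<lambda>_. borel))"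
  unfolding lebesgue_RR_def by (intro sets_PiM_cong) auto

lemma measurable_gauss_density[measurable]:
  "gauss_density d \<in> borel_measurable (PiM {..<d} (\<lambda>_. borel))"
  unfolding gauss_density_def[abs_def] L2_set_def by measurable

lemma gauss_density_nonneg: "0 \<le> gauss_density d x"
  by (simp add: gauss_density_def)

lemma measurable_mix_density[measurable]:
  "mix_density d \<epsilon> \<mu> \<in> borel_measurable (PiM {..<d} (\<lambda>_. borel))"
  unfolding mix_density_def[abs_def] by measurable

lemma density_gauss_density: "density (lebesgue_RR d) (\<lambda>x. ennreal (gauss_density d x)) = gauss d"
proof -
  have "gauss_density d x = gauss_density d (\<lambda>j\<in>{..<d}. x j - 0)" for x
    by (simp add: gauss_density_def L2_set_def)
  then have "density (lebesgue_RR d) (\<lambda>x. ennreal (gauss_density d x))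
      = distr (gauss d) (gauss d) (\<lambda>z. \<lambda>j\<in>{..<d}. z j + 0)"
    using density_gauss_shift[of d "\<lambda>_. 0"] by simp
  also have "\<dots> = distr (gauss d) (gauss d) (\<lambda>z. z)"
    by (intro distr_cong) (auto simp: space_gauss PiE_iff extensional_def)
  finally show ?thesis
    by (simp add: distr_id2)
qed

abbreviation mix_law :: "nat \<Rightarrow> real \<Rightarrow> (nat \<Rightarrow> real) \<Rightarrow> (nat \<Rightarrow> real) measure" where
  "mix_law d \<epsilon> \<mu> \<equiv> density (lebesgue_RR d) (\<lambda>x. ennreal (mix_density d \<epsilon> \<mu> x))"

text \<open>A mixture density is turned here into a two-point mixture of laws: with weight \<open>\<epsilon>\<close> the noise is
shifted by \<open>\<mu>\<close>.\<close>

lemma nn_integral_mix_law: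
  assumes f[measurable]: "f \<in> borel_measurable (PiM {..<d} (\<lambda>_. borel))" and "0 \<le> \<epsilon>" "\<epsilon> \<le> 1"
  shows "(\<integral>\<^sup>+x. f x \<partial>mix_law d \<epsilon> \<mu>)
    = ennreal (1 - \<epsilon>) * (\<integral>\<^sup>+z. f z \<partial>gauss d) + ennreal \<epsilon> * (\<integral>\<^sup>+z. f (\<lambda>j\<in>{..<d}. z j + \<mu> j) \<partial>gauss d)"
proof -
  let ?g = "\<lambda>x. gauss_density d (\<lambda>j\<in>{..<d}. x j - \<mu> j)"
  note [measurable_cong] = sets_lebesgue_RR sets_gauss
  have "(\<integral>\<^sup>+x. f x \<partial>mix_law d \<epsilon> \<mu>)
      = (\<integral>\<^sup>+x. ennreal (1 - \<epsilon>) * (ennreal (gauss_density d x) * f x)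
               + ennreal \<epsilon> * (ennreal (?g x) * f x) \<partial>lebesgue_RR d)"
    using assms(2,3)
    by (subst nn_integral_density)
      (auto intro!: nn_integral_cong simp: mix_density_def ennreal_mult ennreal_plus
        gauss_density_nonneg distrib_right mult.assoc)
  also have "\<dots> = ennreal (1 - \<epsilon>) * (\<integral>\<^sup>+x. ennreal (gauss_density d x) * f x \<partial>lebesgue_RR d)
      + ennreal \<epsilon> * (\<integral>\<^sup>+x. ennreal (?g x) * f x \<partial>lebesgue_RR d)"
    by (simp add: nn_integral_add nn_integral_cmult)
  also have "(\<integral>\<^sup>+x. ennreal (gauss_density d x) * f x \<partial>lebesgue_RR d) = (\<integral>\<^sup>+z. f z \<partial>gauss d)"
    by (subst density_gauss_density[symmetric], subst nn_integral_density) auto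
  also have "(\<integral>\<^sup>+x. ennreal (?g x) * f x \<partial>lebesgue_RR d)
      = (\<integral>\<^sup>+x. f x \<partial>density (lebesgue_RR d) (\<lambda>x. ennreal (?g x)))"
    by (subst nn_integral_density) auto
  also have "\<dots> = (\<integral>\<^sup>+z. f (\<lambda>j\<in>{..<d}. z j + \<mu> j) \<partial>gauss d)"
    unfolding density_gauss_shift by (subst nn_integral_distr) auto
  finally show ?thesis .
qed

lemma prob_space_mix_law:
  assumes "0 \<le> \<epsilon>" "\<epsilon> \<le> 1"
  shows "prob_space (mix_law d \<epsilon> \<mu>)"
proof
  interpret G: prob_space "gauss d"
    by (rule prob_space_gauss)
  show "emeasure (mix_law d \<epsilon> \<mu>) (space (mix_law d \<epsilon> \<mu>)) = 1"
    using nn_integral_mix_law[of "\<lambda>_. 1" d \<epsilon> \<mu>] assms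
    by (simp add: G.emeasure_space_1 flip: ennreal_plus)
qed

text \<open>The sum of the sample has the law of \<open>\<surd>n Z + K \<mu>\<close> with \<open>Z\<close> standard Gaussian and \<open>K\<close>, the number of
observations with shifted mean, an independent binomial variable. By induction on \<open>n\<close>: the new
observation \<open>Y + B \<mu>\<close> turns \<open>\<surd>n Z + Y\<close> into \<open>\<surd>(n+1)\<close> times a standard Gaussian vector and the pair
\<open>(K, B)\<close> into a binomial variable with parameter \<open>n + 1\<close>.\<close>

proposition nn_integral_sum_mix_law:
  assumes "f \<in> borel_measurable (PiM {..<d} (\<lambda>_. borel))" and \<epsilon>: "0 \<le> \<epsilon>" "\<epsilon> \<le> 1"
  shows "(\<integral>\<^sup>+X. f (\<lambda>j\<in>{..<d}. \<Sum>i<n. X i j) \<partial>PiM {..<n} (\<lambda>_. mix_law d \<epsilon> \<mu>))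
    = (\<integral>\<^sup>+k. \<integral>\<^sup>+z. f (\<lambda>j\<in>{..<d}. sqrt (real n) * z j + real k * \<mu> j) \<partial>gauss d \<partial>binomial_pmf n \<epsilon>)"
  using assms(1)
proof (induction n arbitrary: f)
  case 0
  interpret G: prob_space "gauss d"
    by (rule prob_space_gauss)
  interpret G: prob_space "gauss d"
    by (rule prob_space_gauss)
  interpret M: prob_space "PiM {} (\<lambda>_::nat. mix_law d \<epsilon> \<mu>)"
    by (intro prob_space_PiM prob_space_mix_law \<epsilon>)
  have "(\<integral>\<^sup>+X. f (\<lambda>j\<in>{..<d}. \<Sum>i<(0::nat). X i j) \<partial>PiM {..<0} (\<lambda>_. mix_law d \<epsilon> \<mu>)) = f (\<lambda>j\<in>{..<d}. 0)"
    by (simp add: M.emeasure_space_1)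
  also have "\<dots> = (\<integral>\<^sup>+k. \<integral>\<^sup>+z. f (\<lambda>j\<in>{..<d}. sqrt (real 0) * z j + real k * \<mu> j) \<partial>gauss d \<partial>return_pmf 0)"
    by (simp add: G.emeasure_space_1)
  also have "return_pmf 0 = binomial_pmf 0 \<epsilon>"
    using \<epsilon> by (simp add: binomial_pmf_0)
  finally show ?case .
next
  case (Suc n)
  note f[measurable] = Suc.prems
  note [measurable_cong] = sets_lebesgue_RR sets_gauss
  interpret M: product_prob_space "\<lambda>_. mix_law d \<epsilon> \<mu>" "UNIV :: nat set"
    by (intro product_prob_spaceI prob_space_mix_law \<epsilon>)
  interpret G: prob_space "gauss d"
    by (rule prob_space_gauss)
  define G where "G = (\<lambda>k::nat. \<integral>\<^sup>+z. f (\<lambda>j\<in>{..<d}. sqrt (real (Suc n)) * z j + real k * \<mu> j) \<partial>gauss d)"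
  \<comment> \<open>The new observation is integrated out first, for a fixed value \<open>v\<close> of the sum of the others;
    the induction hypothesis then applies to the function \<open>H\<close>.\<close>
  define H where "H v = (\<integral>\<^sup>+x. f (\<lambda>j\<in>{..<d}. v j + x j) \<partial>mix_law d \<epsilon> \<mu>)" for v
  have H: "H v = ennreal (1 - \<epsilon>) * (\<integral>\<^sup>+y. f (\<lambda>j\<in>{..<d}. v j + y j) \<partial>gauss d)
      + ennreal \<epsilon> * (\<integral>\<^sup>+y. f (\<lambda>j\<in>{..<d}. v j + (y j + \<mu> j)) \<partial>gauss d)"
    if "v \<in> space (PiM {..<d} (\<lambda>_. borel))" for v
    unfolding H_def using that \<epsilon> by (subst nn_integral_mix_law) (auto cong: restrict_cong)
  have "(\<integral>\<^sup>+X. f (\<lambda>j\<in>{..<d}. \<Sum>i<Suc n. X i j) \<partial>PiM {..<Suc n} (\<lambda>_. mix_law d \<epsilon> \<mu>))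
      = (\<integral>\<^sup>+X. \<integral>\<^sup>+x. f (\<lambda>j\<in>{..<d}. \<Sum>i<Suc n. (X(n := x)) i j) \<partial>mix_law d \<epsilon> \<mu> \<partial>PiM {..<n} (\<lambda>_. mix_law d \<epsilon> \<mu>))"
    unfolding lessThan_Suc
  proof (intro M.product_nn_integral_insert)
    have [measurable]: "(\<lambda>X. X i j) \<in> borel_measurable (PiM (insert n {..<n}) (\<lambda>_. mix_law d \<epsilon> \<mu>))"
      if "i \<in> insert n {..<n}" "j \<in> {..<d}" for i j
      using that by (intro measurable_compose[OF measurable_component_singleton[of i]]) auto
    show "(\<lambda>X. f (\<lambda>j\<in>{..<d}. \<Sum>i\<in>insert n {..<n}. X i j))
        \<in> borel_measurable (PiM (insert n {..<n}) (\<lambda>_. mix_law d \<epsilon> \<mu>))"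
      by measurable
  qed auto
  also have "\<dots> = (\<integral>\<^sup>+X. H (\<lambda>j\<in>{..<d}. \<Sum>i<n. X i j) \<partial>PiM {..<n} (\<lambda>_. mix_law d \<epsilon> \<mu>))"
    unfolding H_def by (intro nn_integral_cong arg_cong[where f=f] restrict_ext) simp
  also have "\<dots> = (\<integral>\<^sup>+k. \<integral>\<^sup>+z. H (\<lambda>j\<in>{..<d}. sqrt (real n) * z j + real k * \<mu> j) \<partial>gauss d \<partial>binomial_pmf n \<epsilon>)"
  proof (rule Suc.IH)
    show "H \<in> borel_measurable (PiM {..<d} (\<lambda>_. borel))"
      unfolding H_def[abs_def] by measurable
  qed
  also have "\<dots> = (\<integral>\<^sup>+k. ennreal (1 - \<epsilon>) * G k + ennreal \<epsilon> * G (Suc k) \<partial>binomial_pmf n \<epsilon>)"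
  proof (rule nn_integral_cong)
    fix k
    have conv: "(\<integral>\<^sup>+z. \<integral>\<^sup>+y. f (\<lambda>j\<in>{..<d}. sqrt (real n) * z j + y j + real m * \<mu> j) \<partial>gauss d \<partial>gauss d) = G m" for m
    proof -
      have "(\<integral>\<^sup>+z. \<integral>\<^sup>+y. f (\<lambda>j\<in>{..<d}. sqrt (real n) * z j + y j + real m * \<mu> j) \<partial>gauss d \<partial>gauss d)
        = (\<integral>\<^sup>+z. \<integral>\<^sup>+y. (\<lambda>v. f (\<lambda>j\<in>{..<d}. v j + real m * \<mu> j))
            (\<lambda>j\<in>{..<d}. sqrt (real n) * z j + y j) \<partial>gauss d \<partial>gauss d)"
        by (simp cong: restrict_cong)
      also have "\<dots> = (\<integral>\<^sup>+z. (\<lambda>v. f (\<lambda>j\<in>{..<d}. v j + real m * \<mu> j))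
            (\<lambda>j\<in>{..<d}. sqrt ((sqrt (real n))\<^sup>2 + 1) * z j) \<partial>gauss d)"
        proof (rule gauss_convolution)
          show "(\<lambda>v. f (\<lambda>j\<in>{..<d}. v j + real m * \<mu> j)) \<in> borel_measurable (PiM {..<d} (\<lambda>_. borel))"
            by (rule measurable_compose[OF measurable_restrict f]) measurable
        qed simp
      also have "\<dots> = G m"
        unfolding G_def by (simp add: add.commute cong: restrict_cong)
      finally show ?thesis .
    qed
    have "(\<integral>\<^sup>+z. H (\<lambda>j\<in>{..<d}. sqrt (real n) * z j + real k * \<mu> j) \<partial>gauss d)
      = (\<integral>\<^sup>+z. ennreal (1 - \<epsilon>) * (\<integral>\<^sup>+y. f (\<lambda>j\<in>{..<d}. sqrt (real n) * z j + y j + real k * \<mu> j) \<partial>gauss d)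
          + ennreal \<epsilon> * (\<integral>\<^sup>+y. f (\<lambda>j\<in>{..<d}. sqrt (real n) * z j + y j + real (Suc k) * \<mu> j) \<partial>gauss d) \<partial>gauss d)"
      by (intro nn_integral_cong, subst H) (auto simp: space_PiM algebra_simps cong: restrict_cong)
    also have "\<dots> = ennreal (1 - \<epsilon>) * G k + ennreal \<epsilon> * G (Suc k)"
      by (subst nn_integral_add) (auto simp: nn_integral_cmult conv simp del: of_nat_Suc)
    finally show "(\<integral>\<^sup>+z. H (\<lambda>j\<in>{..<d}. sqrt (real n) * z j + real k * \<mu> j) \<partial>gauss d)
       = ennreal (1 - \<epsilon>) * G k + ennreal \<epsilon> * G (Suc k)" .
  qed
  also have "\<dots> = ennreal (1 - \<epsilon>) * (\<integral>\<^sup>+k. G k \<partial>binomial_pmf n \<epsilon>)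
      + ennreal \<epsilon> * (\<integral>\<^sup>+k. G (Suc k) \<partial>binomial_pmf n \<epsilon>)"
    by (simp add: nn_integral_add nn_integral_cmult)
  also have "\<dots> = (\<integral>\<^sup>+k. G k \<partial>binomial_pmf (Suc n) \<epsilon>)"
    using \<epsilon> by (simp add: binomial_pmf_Suc mult.commute add.commute)
  finally show ?case
    unfolding G_def .
qed

section \<open>Second moments and tails\<close>

text \<open>The square of the sum is expanded; by independence and centring, the mixed terms have expectation
zero.\<close>

lemma second_moment_sum_gauss:
  fixes h :: "nat \<Rightarrow> real \<Rightarrow> real"
  assumes [measurable]: "\<And>j. h j \<in> borel_measurable borel"
    and sq: "\<And>j. integrable stdN (\<lambda>t. (h j t)\<^sup>2)"
    and mean: "\<And>j. integral\<^sup>L stdN (h j) = 0"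
  shows "integrable (gauss d) (\<lambda>z. (\<Sum>j<d. h j (z j))\<^sup>2)" (is ?int)
    and "integral\<^sup>L (gauss d) (\<lambda>z. (\<Sum>j<d. h j (z j))\<^sup>2) = (\<Sum>j<d. integral\<^sup>L stdN (\<lambda>t. (h j t)\<^sup>2))" (is ?eq)
proof -
  have int: "integrable stdN (h j)" for j
    using stdN.square_integrable_imp_integrable[OF _ sq[of j]] by simp
  \<comment> \<open>The term \<open>h i (z i) * h j (z j)\<close> is written as a product over all coordinates \<open>k\<close>, so that
    its integral factorizes.\<close>
  define F where "F i j k t = (if k = i then h i t else 1) * (if k = j then h j t else 1)" for i j k t
  have F_int: "integrable stdN (F i j k)" for i j k
    unfolding F_def[abs_def] using sq[of i] int[of i] int[of j]
    by (cases "k = i"; cases "k = j") (auto simp: power2_eq_square)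
  have F_prod: "(\<Prod>k<d. F i j k (z k)) = h i (z i) * h j (z j)" if "i < d" "j < d" for i j z
    using that by (simp add: F_def prod.distrib)
  have F_expect: "(\<Prod>k<d. integral\<^sup>L stdN (F i j k))
      = (if i = j then integral\<^sup>L stdN (\<lambda>t. (h i t)\<^sup>2) else 0)"
    if "i < d" "j < d" for i j
  proof (cases "i = j")
    case True
    then have "integral\<^sup>L stdN (F i j k) = (if k = i then integral\<^sup>L stdN (\<lambda>t. (h i t)\<^sup>2) else 1)" for k
      using stdN.prob_space by (auto simp: F_def[abs_def] power2_eq_square)
    then show ?thesis
      using True that by simp
  next
    case False
    then have "integral\<^sup>L stdN (F i j i) = 0"
      by (simp add: F_def[abs_def] mean)
    then show ?thesis
      using False that by auto
  qed
  have pair_int: "integrable (gauss d) (\<lambda>z. h i (z i) * h j (z j))"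
    and pair_eq: "integral\<^sup>L (gauss d) (\<lambda>z. h i (z i) * h j (z j))
      = (if i = j then integral\<^sup>L stdN (\<lambda>t. (h i t)\<^sup>2) else 0)"
    if "i < d" "j < d" for i j
  proof -
    show "integrable (gauss d) (\<lambda>z. h i (z i) * h j (z j))"
      using stdN_product.product_integrable_prod[of "{..<d}" "F i j"] F_int that
      by (simp add: gauss_def F_prod)
    show "integral\<^sup>L (gauss d) (\<lambda>z. h i (z i) * h j (z j))
      = (if i = j then integral\<^sup>L stdN (\<lambda>t. (h i t)\<^sup>2) else 0)"
      using stdN_product.product_integral_prod[of "{..<d}" "F i j"] F_int that
      by (simp add: gauss_def F_prod F_expect)
  qed
  have expand: "(\<Sum>j<d. h j (z j))\<^sup>2 = (\<Sum>i<d. \<Sum>j<d. h i (z i) * h j (z j))" for z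
    by (simp add: power2_eq_square sum_product)
  show ?int
    unfolding expand by (intro Bochner_Integration.integrable_sum pair_int) auto
  have "integral\<^sup>L (gauss d) (\<lambda>z. (\<Sum>j<d. h j (z j))\<^sup>2)
      = (\<Sum>i<d. \<Sum>j<d. integral\<^sup>L (gauss d) (\<lambda>z. h i (z i) * h j (z j)))"
    unfolding expand
    by (subst Bochner_Integration.integral_sum; (intro sum.cong refl Bochner_Integration.integral_sum)?)
      (auto intro!: Bochner_Integration.integrable_sum pair_int)
  also have "\<dots> = (\<Sum>j<d. integral\<^sup>L stdN (\<lambda>t. (h j t)\<^sup>2))"
    by (intro sum.cong refl) (simp add: pair_eq)
  finally show ?eq .
qed

lemma gauss_sum_tail:
  fixes h :: "nat \<Rightarrow> real \<Rightarrow> real"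
  assumes [measurable]: "\<And>j. h j \<in> borel_measurable borel"
    and sq: "\<And>j. integrable stdN (\<lambda>t. (h j t)\<^sup>2)"
    and mean: "\<And>j. integral\<^sup>L stdN (h j) = 0"
    and "0 < t"
  shows "measure (gauss d) {z \<in> space (gauss d). t \<le> \<bar>\<Sum>j<d. h j (z j)\<bar>}
    \<le> (\<Sum>j<d. integral\<^sup>L stdN (\<lambda>t. (h j t)\<^sup>2)) / t\<^sup>2"
proof -
  interpret G: prob_space "gauss d"
    by (rule prob_space_gauss)
  note [measurable_cong] = sets_gauss
  show ?thesis
    using G.second_moment_method[of "\<lambda>z. \<Sum>j<d. h j (z j)" t] second_moment_sum_gauss[of h d] assms
    by simp
qed

lemma stdN_moments:
  "integral\<^sup>L stdN (\<lambda>t. t) = 0" "integral\<^sup>L stdN (\<lambda>t. t\<^sup>2) = 1" "integral\<^sup>L stdN (\<lambda>t. t ^ 4) = 3"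
  using integral_std_normal_distribution_moment_odd[of 1]
    std_normal_distribution_even_moments(1)[of 1] std_normal_distribution_even_moments(1)[of 2]
  by (simp_all add: fact_numeral)

text \<open>Chebyshev's inequality for the chi-squared law, whose variance is \<open>2 d\<close> because
\<open>Z\<^sup>2 - 1\<close> has variance \<open>3 - 2 + 1 = 2\<close>.\<close>

lemma gauss_norm_square_tail:
  assumes "0 < t"
  shows "measure (gauss d) {z \<in> space (gauss d). t \<le> \<bar>(\<Sum>j<d. (z j)\<^sup>2) - real d\<bar>} \<le> 2 * real d / t\<^sup>2"
proof -
  have exp: "(x\<^sup>2 - 1)\<^sup>2 = x ^ 4 - 2 * x\<^sup>2 + 1" for x :: real
    by algebra
  have one: "measure stdN UNIV = 1"
    using stdN.prob_space by simp
  have "integral\<^sup>L stdN (\<lambda>x. (x\<^sup>2 - 1)\<^sup>2) = 2"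
    unfolding exp by (simp add: integrable_std_normal_distribution_moment stdN_moments one)
  moreover have "integrable stdN (\<lambda>x. (x\<^sup>2 - 1)\<^sup>2)"
    unfolding exp by (simp add: integrable_std_normal_distribution_moment)
  moreover have "integral\<^sup>L stdN (\<lambda>x. x\<^sup>2 - 1) = 0"
    by (simp add: integrable_std_normal_distribution_moment stdN_moments one)
  ultimately show ?thesis
    using gauss_sum_tail[of "\<lambda>_ x. x\<^sup>2 - 1" t d] assms
    by (simp add: sum_subtractf mult.commute)
qed

lemma gauss_linear_tail:
  assumes "0 < t"
  shows "measure (gauss d) {z \<in> space (gauss d). t \<le> \<bar>\<Sum>j<d. \<mu> j * z j\<bar>} \<le> (L2_set \<mu> {..<d})\<^sup>2 / t\<^sup>2"
  using gauss_sum_tail[of "\<lambda>j x. \<mu> j * x" t d] assms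
  by (simp add: power_mult_distrib integrable_std_normal_distribution_moment stdN_moments
      L2_set_def sum_nonneg)

text \<open>Chebyshev's inequality; the variance of the binomial law is read off from the identities for sums
of Bernstein polynomials.\<close>

lemma binomial_tail:
  assumes "0 \<le> p" "p \<le> 1" "0 < t"
  shows "measure_pmf.prob (binomial_pmf n p) {k. t \<le> \<bar>real k - real n * p\<bar>} \<le> real n * p * (1 - p) / t\<^sup>2"
proof -
  have p: "p \<in> {0..1}"
    using assms by simp
  have "measure_pmf.expectation (binomial_pmf n p) (\<lambda>k. (real k - real n * p)\<^sup>2)
     = (\<Sum>k\<le>n. Bernstein n k p * (real k - real n * p)\<^sup>2)"
    by (simp add: expectation_binomial_pmf'[OF p] Bernstein_def)
  also have "\<dots> = (\<Sum>k\<le>n. real k * (real k - 1) * Bernstein n k p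
      + (1 - 2 * real n * p) * (real k * Bernstein n k p) + (real n * p)\<^sup>2 * Bernstein n k p)"
    by (intro sum.cong refl) algebra
  also have "\<dots> = real n * p * (1 - p)"
    by (simp add: sum.distrib flip: sum_distrib_left) (simp add: algebra_simps power2_eq_square)
  finally show ?thesis
    using measure_pmf.second_moment_method[of "\<lambda>k. real k - real n * p" "binomial_pmf n p" t] p assms(3)
    by simp
qed

section \<open>Quantiles\<close>

text \<open>Right continuity of the distribution function makes the infimum in the definition of the quantile
a minimum. The bound \<open>0 < p\<close> keeps the set of which it is the infimum bounded below.\<close>

lemma
  assumes "real_distribution N" and "0 < p" and "p \<le> cdf N t"
  shows quantile_le: "quantile N p \<le> t"
    and le_cdf_quantile: "p \<le> cdf N (quantile N p)"
proof -
  interpret real_distribution N by fact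
  let ?A = "{t. p \<le> cdf N t}"
  have "\<forall>\<^sub>F x in at_bot. cdf N x < p"
    using cdf_lim_at_bot \<open>0 < p\<close> by (rule order_tendstoD)
  then obtain x where x: "\<And>y. y \<le> x \<Longrightarrow> cdf N y < p"
    by (auto simp: eventually_at_bot_linorder)
  have bdd: "bdd_below ?A"
  proof (rule bdd_belowI)
    fix y assume "y \<in> ?A"
    then show "x \<le> y"
      using x[of y] by force
  qed
  then show "quantile N p \<le> t"
    unfolding quantile_def using assms(3) by (intro cInf_lower) auto
  show "p \<le> cdf N (quantile N p)"
  proof (rule tendsto_lowerbound)
    show "(cdf N \<longlongrightarrow> cdf N (quantile N p)) (at_right (quantile N p))"
      using cdf_is_right_cont by (simp add: continuous_within)
    show "\<forall>\<^sub>F s in at_right (quantile N p). p \<le> cdf N s"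
      unfolding eventually_at_filter
    proof (intro always_eventually allI impI)
      fix s assume "s \<in> {quantile N p<..}"
      then obtain u where "u \<in> ?A" "u < s"
        using assms(3) cInf_lessD[of ?A s] by (auto simp: quantile_def)
      then show "p \<le> cdf N s"
        using cdf_nondecreasing[of u s] by auto
    qed
  qed simp
qed

section \<open>The test statistic\<close>

text \<open>The squared norm of \<open>\<surd>n\<close> times the sample mean, written so that it visibly depends on the sample only
through its sum; this is what makes \<open>nn_integral_sum_mix_law\<close> applicable.\<close>

definition test_stat :: "nat \<Rightarrow> nat \<Rightarrow> (nat \<Rightarrow> nat \<Rightarrow> real) \<Rightarrow> real" where
  "test_stat n d X = (\<Sum>j<d. ((\<Sum>i<n. X i j) / sqrt (real n))\<^sup>2)"

lemma Psi1_eq: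
  "Psi1 n d \<alpha> X = (if quantile (chi_squared d) (1 - \<alpha>) < test_stat n d X then 1 else 0)"
proof -
  have "(L2_set (\<lambda>j\<in>{..<d}. sqrt (real n) * sample_mean n d X j) {..<d})\<^sup>2
      = (\<Sum>j<d. (sqrt (real n) * sample_mean n d X j)\<^sup>2)"
    by (simp add: L2_set_def sum_nonneg)
  also have "\<dots> = test_stat n d X"
    unfolding test_stat_def
  proof (intro sum.cong refl arg_cong[where f="\<lambda>x. x\<^sup>2"])
    fix j assume "j \<in> {..<d}"
    then have "sqrt (real n) * sample_mean n d X j = sqrt (real n) / real n * (\<Sum>i<n. X i j)"
      by (simp add: sample_mean_def)
    then show "sqrt (real n) * sample_mean n d X j = (\<Sum>i<n. X i j) / sqrt (real n)"
      by (simp only: sqrt_divide_self_eq[OF of_nat_0_le_iff]) (simp add: field_simps)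
  qed
  finally show ?thesis
    by (simp add: Psi1_def)
qed

lemma measurable_test_stat[measurable]:
  "test_stat n d \<in> borel_measurable (PiM {..<n} (\<lambda>_. PiM {..<d} (\<lambda>_. borel)))"
proof -
  have [measurable]: "(\<lambda>X. X i j) \<in> borel_measurable (PiM {..<n} (\<lambda>_. PiM {..<d} (\<lambda>_. borel)))"
    if "i \<in> {..<n}" "j \<in> {..<d}" for i j
    using that by (intro measurable_compose[OF measurable_component_singleton[of i]]) auto
  show ?thesis
    unfolding test_stat_def[abs_def] by measurable
qed

lemma is_test_Psi1: "is_test n d (Psi1 n d \<alpha>)"
proof -
  have "(\<lambda>X. if quantile (chi_squared d) (1 - \<alpha>) < test_stat n d X then 1 else 0)
      \<in> measurable (PiM {..<n} (\<lambda>_. PiM {..<d} (\<lambda>_. borel))) (count_space {0, 1 :: nat})"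
    by measurable
  then show ?thesis
    by (simp add: is_test_def Psi1_eq[abs_def])
qed

text \<open>Given that \<open>k\<close> observations are shifted, the statistic is a noncentral chi-squared variable: the
squared norm of a standard Gaussian vector moved by \<open>(k / \<surd>n) \<mu>\<close>.\<close>

lemma sample_prob_test_stat:
  assumes \<epsilon>: "0 \<le> \<epsilon>" "\<epsilon> \<le> 1" and n: "1 \<le> n" and [measurable]: "B \<in> sets borel"
  shows "ennreal (sample_prob n d (mix_density d \<epsilon> \<mu>) (\<lambda>X. test_stat n d X \<in> B))
    = (\<integral>\<^sup>+k. emeasure (gauss d) {z \<in> space (gauss d). (\<Sum>j<d. (z j + real k / sqrt (real n) * \<mu> j)\<^sup>2) \<in> B}
         \<partial>binomial_pmf n \<epsilon>)"
proof -
  note [measurable_cong] = sets_gauss sets_lebesgue_RR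
  let ?P = "PiM {..<n} (\<lambda>_. mix_law d \<epsilon> \<mu>)"
  interpret P: prob_space ?P
    by (intro prob_space_PiM prob_space_mix_law \<epsilon>)
  define f :: "(nat \<Rightarrow> real) \<Rightarrow> ennreal"
    where "f v = indicator B (\<Sum>j<d. (v j / sqrt (real n))\<^sup>2)" for v
  have f_meas: "f \<in> borel_measurable (PiM {..<d} (\<lambda>_. borel))"
    unfolding f_def[abs_def] by measurable
  have sets_P: "sets ?P = sets (PiM {..<n} (\<lambda>_. PiM {..<d} (\<lambda>_. borel)))"
    by (intro sets_PiM_cong) (simp_all add: sets_lebesgue_RR)
  have [measurable]: "test_stat n d \<in> borel_measurable ?P"
    using measurable_test_stat measurable_cong_sets[OF sets_P refl] by blast
  have "ennreal (sample_prob n d (mix_density d \<epsilon> \<mu>) (\<lambda>X. test_stat n d X \<in> B))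
      = emeasure ?P {X \<in> space ?P. test_stat n d X \<in> B}"
    by (simp add: sample_prob_def sample_law_def P.emeasure_eq_measure)
  also have "\<dots> = (\<integral>\<^sup>+X. indicator {X \<in> space ?P. test_stat n d X \<in> B} X \<partial>?P)"
    by (rule nn_integral_indicator[symmetric]) measurable
  also have "\<dots> = (\<integral>\<^sup>+X. f (\<lambda>j\<in>{..<d}. \<Sum>i<n. X i j) \<partial>?P)"
    by (intro nn_integral_cong) (simp add: f_def test_stat_def indicator_def)
  also have "\<dots> = (\<integral>\<^sup>+k. \<integral>\<^sup>+z. f (\<lambda>j\<in>{..<d}. sqrt (real n) * z j + real k * \<mu> j) \<partial>gauss d \<partial>binomial_pmf n \<epsilon>)"
    by (rule nn_integral_sum_mix_law[OF f_meas \<epsilon>])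
  also have "\<dots> = (\<integral>\<^sup>+k. \<integral>\<^sup>+z. indicator {z \<in> space (gauss d). (\<Sum>j<d. (z j + real k / sqrt (real n) * \<mu> j)\<^sup>2) \<in> B} z
         \<partial>gauss d \<partial>binomial_pmf n \<epsilon>)"
    using n by (intro nn_integral_cong) (simp add: f_def indicator_def add_divide_distrib)
  also have "\<dots> = (\<integral>\<^sup>+k. emeasure (gauss d) {z \<in> space (gauss d). (\<Sum>j<d. (z j + real k / sqrt (real n) * \<mu> j)\<^sup>2) \<in> B}
         \<partial>binomial_pmf n \<epsilon>)"
    by (intro nn_integral_cong nn_integral_indicator) measurable
  finally show ?thesis .
qed

section \<open>The critical value and the level\<close>

lemma chi_squared_eq: "chi_squared d = distr (gauss d) borel (\<lambda>z. \<Sum>j<d. (z j)\<^sup>2)"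
  by (simp add: chi_squared_def gauss_def)

lemma measurable_norm_square_gauss[measurable]: "(\<lambda>z. \<Sum>j<d. (z j)\<^sup>2) \<in> borel_measurable (gauss d)"
  by (subst measurable_cong_sets[OF sets_gauss refl]) measurable

lemma real_distribution_chi_squared: "real_distribution (chi_squared d)"
proof -
  interpret G: prob_space "gauss d"
    by (rule prob_space_gauss)
  show ?thesis
    unfolding chi_squared_eq by (rule G.real_distribution_distr) measurable
qed

lemma cdf_chi_squared:
  "cdf (chi_squared d) t = 1 - measure (gauss d) {z \<in> space (gauss d). t < (\<Sum>j<d. (z j)\<^sup>2)}"
proof -
  interpret G: prob_space "gauss d"
    by (rule prob_space_gauss)
  have "cdf (chi_squared d) t = measure (gauss d) {z \<in> space (gauss d). \<not> t < (\<Sum>j<d. (z j)\<^sup>2)}"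
    unfolding cdf_def chi_squared_eq
    by (subst measure_distr) (auto intro!: arg_cong[where f="measure (gauss d)"])
  also have "\<dots> = 1 - measure (gauss d) {z \<in> space (gauss d). t < (\<Sum>j<d. (z j)\<^sup>2)}"
    by (rule G.prob_neg) measurable
  finally show ?thesis .
qed

text \<open>The upper bound \<open>d + \<surd>(2 d / \<alpha>)\<close> for the critical value exceeds the mean by a term of
order \<open>\<surd>d\<close>; this is the source of the rate \<open>d powr (1/4)\<close>, since a signal \<open>w\<close> contributes \<open>w\<^sup>2\<close> to the
statistic.\<close>

lemma chi_squared_quantile:
  assumes \<alpha>: "0 < \<alpha>" "\<alpha> < 1" and d: "1 \<le> d"
  defines "q \<equiv> quantile (chi_squared d) (1 - \<alpha>)"
  shows "q \<le> real d + sqrt (2 * real d / \<alpha>)"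
    and "measure (gauss d) {z \<in> space (gauss d). q < (\<Sum>j<d. (z j)\<^sup>2)} \<le> \<alpha>"
proof -
  interpret G: prob_space "gauss d"
    by (rule prob_space_gauss)
  let ?t = "sqrt (2 * real d / \<alpha>)"
  have t: "0 < ?t"
    using \<alpha> d by simp
  have "measure (gauss d) {z \<in> space (gauss d). real d + ?t < (\<Sum>j<d. (z j)\<^sup>2)}
     \<le> measure (gauss d) {z \<in> space (gauss d). ?t \<le> \<bar>(\<Sum>j<d. (z j)\<^sup>2) - real d\<bar>}"
    by (intro G.finite_measure_mono) auto
  also have "\<dots> \<le> 2 * real d / ?t\<^sup>2"
    by (rule gauss_norm_square_tail[OF t])
  also have "\<dots> = \<alpha>"
    using \<alpha> d by simp
  finally have le: "1 - \<alpha> \<le> cdf (chi_squared d) (real d + ?t)"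
    by (simp add: cdf_chi_squared)
  show "q \<le> real d + ?t"
    unfolding q_def using real_distribution_chi_squared _ le by (rule quantile_le) (use \<alpha> in simp)
  have "1 - \<alpha> \<le> cdf (chi_squared d) q"
    unfolding q_def using real_distribution_chi_squared _ le by (rule le_cdf_quantile) (use \<alpha> in simp)
  then show "measure (gauss d) {z \<in> space (gauss d). q < (\<Sum>j<d. (z j)\<^sup>2)} \<le> \<alpha>"
    by (simp add: cdf_chi_squared)
qed

text \<open>The null hypothesis is the mixture with \<open>\<epsilon> = 0\<close>; the binomial variable is then \<open>0\<close> and the statistic
has exactly the chi-squared law.\<close>

proposition has_level_Psi1:
  assumes \<alpha>: "0 < \<alpha>" "\<alpha> < 1" and "1 \<le> n" "1 \<le> d"
  shows "has_level n d \<alpha> (Psi1 n d \<alpha>)"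
proof -
  interpret G: prob_space "gauss d"
    by (rule prob_space_gauss)
  define q where "q = quantile (chi_squared d) (1 - \<alpha>)"
  have "ennreal (sample_prob n d (gauss_density d) (\<lambda>X. Psi1 n d \<alpha> X = 1))
      = ennreal (sample_prob n d (mix_density d 0 (\<lambda>_. 0)) (\<lambda>X. test_stat n d X \<in> {q<..}))"
    by (simp add: mix_density_def[abs_def] Psi1_eq q_def)
  also have "\<dots> = ennreal (measure (gauss d) {z \<in> space (gauss d). q < (\<Sum>j<d. (z j)\<^sup>2)})"
    using assms by (subst sample_prob_test_stat) (simp_all add: G.emeasure_eq_measure measure_pmf.emeasure_space_1)
  also have "\<dots> \<le> ennreal \<alpha>"
    unfolding q_def using assms by (intro ennreal_leI chi_squared_quantile)
  finally show ?thesis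
    using \<alpha> is_test_Psi1 by (simp add: has_level_def)
qed

section \<open>The error of the second kind\<close>

text \<open>This is applied with \<open>s = \<parallel>z\<parallel>\<^sup>2\<close>, with \<open>a\<close> the inner product of \<open>z\<close> and \<open>\<mu>\<close>, and with \<open>m = \<parallel>\<mu>\<parallel>\<close>, where the
right-hand side is \<open>\<parallel>z + c \<mu>\<parallel>\<^sup>2\<close>. With the signal strength \<open>w = c m\<close>, half of \<open>w\<^sup>2\<close> compensates the cross term, which is at
least \<open>- 2 w / \<surd>\<delta>\<close>, and the other half exceeds the fluctuation of \<open>\<parallel>z\<parallel>\<^sup>2\<close> and of the critical value, both
of order \<open>\<surd>d\<close>.\<close>

lemma noncentral_norm_square_gt:
  fixes s a c C :: real
  assumes d: "1 \<le> d" and pos: "0 < \<alpha>" "0 < \<delta>" "0 \<le> c" "0 \<le> m"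
    and s: "\<bar>s - real d\<bar> < sqrt (2 * real d / \<delta>)"
    and a: "\<bar>a\<bar> < m / sqrt \<delta>"
    and w: "C / 2 * real d powr (1/4) \<le> c * m"
    and C: "8 / sqrt \<delta> \<le> C" "8 * (sqrt (2 / \<alpha>) + sqrt (2 / \<delta>)) \<le> C\<^sup>2"
  shows "real d + sqrt (2 * real d / \<alpha>) < s + 2 * c * a + c\<^sup>2 * m\<^sup>2"
proof -
  define w where "w = c * m"
  have "0 \<le> C"
    using C(1) pos(2) by (smt (verit) divide_nonneg_nonneg real_sqrt_ge_zero)
  have "1 \<le> real d powr (1/4)"
    using d by (simp add: ge_one_powr_ge_zero)
  with \<open>0 \<le> C\<close> have "C / 2 \<le> C / 2 * real d powr (1/4)"
    by (simp add: mult_le_cancel_left1)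
  then have w4: "4 / sqrt \<delta> \<le> w" and wd: "C / 2 * real d powr (1/4) \<le> w"
    using w C(1) by (auto simp: w_def)
  have "0 \<le> w"
    using pos by (simp add: w_def)
  have "2 * w / sqrt \<delta> \<le> w\<^sup>2 / 2"
    using mult_left_mono[OF w4 \<open>0 \<le> w\<close>] by (simp add: power2_eq_square mult.commute)
  moreover have "- (w / sqrt \<delta>) \<le> c * a"
  proof -
    have "c * \<bar>a\<bar> \<le> c * (m / sqrt \<delta>)"
      using a pos by (intro mult_left_mono) auto
    then show ?thesis
      using pos by (simp add: w_def abs_if mult.assoc split: if_splits)
        (smt (verit) mult_nonneg_nonneg)
  qed
  moreover have "sqrt (2 * real d / \<alpha>) + sqrt (2 * real d / \<delta>) \<le> w\<^sup>2 / 2"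
  proof -
    have "(real d powr (1/4))\<^sup>2 = sqrt (real d)"
      using d by (simp add: powr_half_sqrt[symmetric] powr_powr flip: powr_numeral)
    then have "(C / 2 * real d powr (1/4))\<^sup>2 = C\<^sup>2 / 4 * sqrt (real d)"
      by (simp add: power_mult_distrib power_divide)
    moreover have "(C / 2 * real d powr (1/4))\<^sup>2 \<le> w\<^sup>2"
      using wd \<open>0 \<le> C\<close> by (intro power_mono) auto
    moreover have "8 * (sqrt (2 / \<alpha>) + sqrt (2 / \<delta>)) * sqrt (real d) \<le> C\<^sup>2 * sqrt (real d)"
      using C(2) by (intro mult_right_mono) auto
    moreover have "sqrt (2 * real d / x) = sqrt (2 / x) * sqrt (real d)" for x
      by (simp add: real_sqrt_mult real_sqrt_divide)
    ultimately show ?thesis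
      by (simp add: algebra_simps)
  qed
  moreover have "real d - sqrt (2 * real d / \<delta>) < s"
    using s by linarith
  ultimately have "real d + sqrt (2 * real d / \<alpha>) < s + 2 * (c * a) + w\<^sup>2"
    by linarith
  then show ?thesis
    by (simp add: w_def power_mult_distrib mult.assoc)
qed

lemma noncentral_norm_square_tail:
  assumes d: "1 \<le> d" and pos: "0 < \<alpha>" "0 < \<delta>" "0 \<le> c" and m: "0 < L2_set \<mu> {..<d}"
    and w: "C / 2 * real d powr (1/4) \<le> c * L2_set \<mu> {..<d}"
    and C: "8 / sqrt \<delta> \<le> C" "8 * (sqrt (2 / \<alpha>) + sqrt (2 / \<delta>)) \<le> C\<^sup>2"
  shows "measure (gauss d) {z \<in> space (gauss d).
      (\<Sum>j<d. (z j + c * \<mu> j)\<^sup>2) \<le> real d + sqrt (2 * real d / \<alpha>)} \<le> 2 * \<delta>"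
proof -
  interpret G: prob_space "gauss d"
    by (rule prob_space_gauss)
  note [measurable_cong] = sets_gauss
  let ?m = "L2_set \<mu> {..<d}"
  let ?A = "{z \<in> space (gauss d). sqrt (2 * real d / \<delta>) \<le> \<bar>(\<Sum>j<d. (z j)\<^sup>2) - real d\<bar>}"
  let ?B = "{z \<in> space (gauss d). ?m / sqrt \<delta> \<le> \<bar>\<Sum>j<d. \<mu> j * z j\<bar>}"
  have expand: "(\<Sum>j<d. (z j + c * \<mu> j)\<^sup>2)
      = (\<Sum>j<d. (z j)\<^sup>2) + 2 * c * (\<Sum>j<d. \<mu> j * z j) + c\<^sup>2 * ?m\<^sup>2" for z
    by (simp add: L2_set_def sum_nonneg power2_sum sum.distrib power_mult_distrib
        sum_distrib_left mult_ac)
  have "{z \<in> space (gauss d). (\<Sum>j<d. (z j + c * \<mu> j)\<^sup>2) \<le> real d + sqrt (2 * real d / \<alpha>)} \<subseteq> ?A \<union> ?B"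
  proof
    fix z assume "z \<in> {z \<in> space (gauss d). (\<Sum>j<d. (z j + c * \<mu> j)\<^sup>2) \<le> real d + sqrt (2 * real d / \<alpha>)}"
    then show "z \<in> ?A \<union> ?B"
      using noncentral_norm_square_gt[OF d pos _ _ _ w C, of "\<Sum>j<d. (z j)\<^sup>2" "\<Sum>j<d. \<mu> j * z j"] m
      unfolding expand by (auto simp: not_le[symmetric])
  qed
  then have "measure (gauss d) {z \<in> space (gauss d). (\<Sum>j<d. (z j + c * \<mu> j)\<^sup>2) \<le> real d + sqrt (2 * real d / \<alpha>)}
      \<le> measure (gauss d) (?A \<union> ?B)"
    by (rule G.finite_measure_mono) measurable
  also have "\<dots> \<le> measure (gauss d) ?A + measure (gauss d) ?B"
    by (rule measure_Un_le) measurable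
  also have "measure (gauss d) ?A \<le> \<delta>"
    using gauss_norm_square_tail[of "sqrt (2 * real d / \<delta>)" d] d pos by simp
  also have "measure (gauss d) ?B \<le> \<delta>"
    using gauss_linear_tail[of "?m / sqrt \<delta>" d \<mu>] m pos by (simp add: power_divide)
  finally show ?thesis by simp
qed

lemma binomial_below_half_mean:
  assumes "0 < p" "p \<le> 1" "1 \<le> n"
  shows "measure_pmf.prob (binomial_pmf n p) {k. real k < real n * p / 2} \<le> 4 / (real n * p)"
proof -
  have np: "0 < real n * p"
    using assms by simp
  have "measure_pmf.prob (binomial_pmf n p) {k. real k < real n * p / 2}
      \<le> measure_pmf.prob (binomial_pmf n p) {k. real n * p / 2 \<le> \<bar>real k - real n * p\<bar>}"
    by (intro measure_pmf.finite_measure_mono) (auto simp: mult.commute)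
  also have "\<dots> \<le> real n * p * (1 - p) / (real n * p / 2)\<^sup>2"
    using assms np by (intro binomial_tail) auto
  also have "\<dots> = 4 * (1 - p) / (real n * p)"
  proof -
    have "x * y / (x / 2)\<^sup>2 = 4 * y / x" if "0 < x" for x y :: real
      using that by (simp add: power2_eq_square)
    then show ?thesis
      using np by blast
  qed
  also have "\<dots> \<le> 4 / (real n * p)"
    using np assms by (intro divide_right_mono) auto
  finally show ?thesis .
qed

text \<open>Three events of probability at most \<open>\<delta>\<close> cover the error: too few shifted observations, a deviation of \<open>\<parallel>Z\<parallel>\<^sup>2\<close>, and a
deviation of the inner product of \<open>Z\<close> and \<open>\<mu>\<close>. If at least half of the expected number \<open>n \<epsilon>\<close> of
observations is shifted, the signal is at least \<open>\<surd>n \<epsilon> \<parallel>\<mu>\<parallel> / 2\<close>, and the separation condition bounds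
this from below by a multiple of \<open>d powr (1/4)\<close>. That \<open>n \<epsilon>\<close> is large, so that the binomial variable
concentrates, is where the bound \<open>\<parallel>\<mu>\<parallel> \<le> M\<close> is used: \<open>C \<le> \<surd>n \<epsilon> \<parallel>\<mu>\<parallel>\<close> implies
\<open>C\<^sup>2 \<le> n \<epsilon> M\<^sup>2\<close>.\<close>

proposition type_II_error_Psi1:
  assumes \<alpha>: "0 < \<alpha>" "\<alpha> < 1" and "0 < \<delta>" "0 < M" and n: "1 \<le> n" and d: "1 \<le> d"
    and \<epsilon>: "0 < \<epsilon>" "\<epsilon> < 1" and M: "L2_set \<mu> {..<d} \<le> M"
    and sep: "C * real d powr (1/4) / sqrt (real n) \<le> \<epsilon> * L2_set \<mu> {..<d}"
    and C: "2 * M / sqrt \<delta> \<le> C" "8 / sqrt \<delta> \<le> C" "8 * (sqrt (2 / \<alpha>) + sqrt (2 / \<delta>)) \<le> C\<^sup>2"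
  shows "sample_prob n d (mix_density d \<epsilon> \<mu>) (\<lambda>X. Psi1 n d \<alpha> X = 0) \<le> 3 * \<delta>"
proof -
  interpret G: prob_space "gauss d"
    by (rule prob_space_gauss)
  note [measurable_cong] = sets_gauss
  let ?m = "L2_set \<mu> {..<d}"
  define q where "q = quantile (chi_squared d) (1 - \<alpha>)"
  define bad where "bad = {k::nat. real k < real n * \<epsilon> / 2}"
  have C0: "0 < C"
    using C(2) \<open>0 < \<delta>\<close> by (smt (verit) divide_pos_pos real_sqrt_gt_zero)
  have r: "C * real d powr (1/4) \<le> sqrt (real n) * \<epsilon> * ?m"
    using sep n by (simp add: divide_le_eq mult_ac)
  have "0 < C * real d powr (1/4)"
    using C0 d by simp
  with r have m: "0 < ?m"
    using \<epsilon> n by (smt (verit) mult_nonneg_nonneg mult_nonneg_nonpos real_sqrt_ge_zero of_nat_0_le_iff)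
  have bad_prob: "measure_pmf.prob (binomial_pmf n \<epsilon>) bad \<le> \<delta>"
  proof -
    have "1 \<le> real d powr (1/4)"
      using d by (simp add: ge_one_powr_ge_zero)
    then have "C \<le> C * real d powr (1/4)"
      using C0 by simp
    also note r
    also have "sqrt (real n) * \<epsilon> * ?m \<le> sqrt (real n) * \<epsilon> * M"
      using M \<epsilon> by (intro mult_left_mono) auto
    finally have "C\<^sup>2 \<le> (sqrt (real n) * \<epsilon> * M)\<^sup>2"
      using C0 by (intro power_mono) auto
    also have "\<dots> = real n * \<epsilon> * M\<^sup>2 * \<epsilon>"
      by (simp add: power_mult_distrib power2_eq_square[of \<epsilon>])
    also have "\<dots> \<le> real n * \<epsilon> * M\<^sup>2"
      using \<epsilon> by (intro mult_right_le_one_le) auto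
    finally have "C\<^sup>2 \<le> real n * \<epsilon> * M\<^sup>2" .
    moreover have "(2 * M / sqrt \<delta>)\<^sup>2 \<le> C\<^sup>2"
      using C(1) \<open>0 < \<delta>\<close> \<open>0 < M\<close> by (intro power_mono) auto
    ultimately have "4 * M\<^sup>2 / \<delta> \<le> real n * \<epsilon> * M\<^sup>2"
      using \<open>0 < \<delta>\<close> by (simp add: power_mult_distrib power_divide)
    then have "4 / \<delta> \<le> real n * \<epsilon>"
      using \<open>0 < M\<close> mult_le_cancel_right_pos[of "M\<^sup>2" "4 / \<delta>" "real n * \<epsilon>"] by simp
    then have "4 / (real n * \<epsilon>) \<le> \<delta>"
      using \<open>0 < \<delta>\<close> \<epsilon> n by (simp add: field_simps)
    then show ?thesis
      using binomial_below_half_mean[of \<epsilon> n] \<epsilon> n unfolding bad_def by simp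
  qed
  have good: "emeasure (gauss d) {z \<in> space (gauss d). (\<Sum>j<d. (z j + real k / sqrt (real n) * \<mu> j)\<^sup>2) \<in> {..q}}
      \<le> ennreal (2 * \<delta>) + indicator bad k" for k
  proof (cases "k \<in> bad")
    case True
    have "emeasure (gauss d) {z \<in> space (gauss d). (\<Sum>j<d. (z j + real k / sqrt (real n) * \<mu> j)\<^sup>2) \<in> {..q}} \<le> 1"
      by (rule G.emeasure_le_1)
    also have "1 \<le> ennreal (2 * \<delta>) + indicator bad k"
      using True by simp
    finally show ?thesis .
  next
    case False
    have "C / 2 * real d powr (1/4) \<le> sqrt (real n) * \<epsilon> / 2 * ?m"
      using r by simp
    also have "\<dots> \<le> real k / sqrt (real n) * ?m"
      using False n m by (intro mult_right_mono) (auto simp: bad_def field_simps not_less)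
    finally have w: "C / 2 * real d powr (1/4) \<le> real k / sqrt (real n) * ?m" .
    have "measure (gauss d) {z \<in> space (gauss d). (\<Sum>j<d. (z j + real k / sqrt (real n) * \<mu> j)\<^sup>2) \<in> {..q}}
       \<le> measure (gauss d) {z \<in> space (gauss d).
      (\<Sum>j<d. (z j + real k / sqrt (real n) * \<mu> j)\<^sup>2) \<le> real d + sqrt (2 * real d / \<alpha>)}"
    proof (rule G.finite_measure_mono)
      show "{z \<in> space (gauss d). (\<Sum>j<d. (z j + real k / sqrt (real n) * \<mu> j)\<^sup>2) \<in> {..q}}
        \<subseteq> {z \<in> space (gauss d). (\<Sum>j<d. (z j + real k / sqrt (real n) * \<mu> j)\<^sup>2) \<le> real d + sqrt (2 * real d / \<alpha>)}"
        using chi_squared_quantile(1)[OF \<alpha> d] unfolding q_def by auto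
    qed measurable
    also have "\<dots> \<le> 2 * \<delta>"
      using noncentral_norm_square_tail[OF d \<alpha>(1) \<open>0 < \<delta>\<close> _ m w C(2,3)] by simp
    finally show ?thesis
      using False by (simp add: G.emeasure_eq_measure ennreal_leI)
  qed
  have "ennreal (sample_prob n d (mix_density d \<epsilon> \<mu>) (\<lambda>X. Psi1 n d \<alpha> X = 0))
      = ennreal (sample_prob n d (mix_density d \<epsilon> \<mu>) (\<lambda>X. test_stat n d X \<in> {..q}))"
    by (simp add: Psi1_eq q_def not_less)
  also have "\<dots> = (\<integral>\<^sup>+k. emeasure (gauss d) {z \<in> space (gauss d).
      (\<Sum>j<d. (z j + real k / sqrt (real n) * \<mu> j)\<^sup>2) \<in> {..q}} \<partial>binomial_pmf n \<epsilon>)"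
    using \<epsilon> n by (intro sample_prob_test_stat) auto
  also have "\<dots> \<le> (\<integral>\<^sup>+k. ennreal (2 * \<delta>) + indicator bad k \<partial>binomial_pmf n \<epsilon>)"
    by (intro nn_integral_mono good)
  also have "\<dots> = ennreal (2 * \<delta>) + ennreal (measure_pmf.prob (binomial_pmf n \<epsilon>) bad)"
    by (subst nn_integral_add) (simp_all add: measure_pmf.emeasure_eq_measure)
  also have "\<dots> \<le> ennreal (2 * \<delta>) + ennreal \<delta>"
    using bad_prob by (intro add_left_mono ennreal_leI)
  also have "\<dots> = ennreal (3 * \<delta>)"
    using \<open>0 < \<delta>\<close> by (simp flip: ennreal_plus)
  finally show ?thesis
    using \<open>0 < \<delta>\<close> by simp
qed

theorem theorem4:
  fixes \<alpha> \<beta> M :: real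
  assumes "0 < \<alpha>" "\<alpha> < 1" "0 < \<beta>" "\<beta> < 1" "0 < M"
  shows "(\<forall>n\<ge>1. \<forall>d\<ge>1. has_level n d \<alpha> (Psi1 n d \<alpha>)) \<and>
    (\<exists>C>0. \<forall>n\<ge>1. \<forall>d\<ge>1. \<forall>\<rho>>0. \<rho> \<ge> C * real d powr (1/4) / sqrt (real n) \<longrightarrow>
       sup0 {sample_prob n d (mix_density d \<epsilon> \<mu>) (\<lambda>X. Psi1 n d \<alpha> X = 0) | \<epsilon> \<mu>.
               (\<epsilon>, \<mu>) \<in> F2_params d M \<and> \<epsilon> * L2_set \<mu> {..<d} \<ge> \<rho>} \<le> \<beta>)"
proof
  show "\<forall>n\<ge>1. \<forall>d\<ge>1. has_level n d \<alpha> (Psi1 n d \<alpha>)"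
    using assms by (simp add: has_level_Psi1)
next
  \<comment> \<open>Each of the three error events gets probability at most \<open>\<beta> / 3\<close>. The summands of \<open>C\<close> are what is needed for,
    in this order, the binomial count, the cross term and the chi-squared fluctuations.\<close>
  define \<delta> where "\<delta> = \<beta> / 3"
  define K where "K = 8 * (sqrt (2 / \<alpha>) + sqrt (2 / \<delta>))"
  define C where "C = 2 * M / sqrt \<delta> + 8 / sqrt \<delta> + sqrt K"
  have "0 < \<delta>" "0 \<le> K"
    using assms by (auto simp: \<delta>_def K_def)
  have parts: "0 < 2 * M / sqrt \<delta>" "0 < 8 / sqrt \<delta>" "0 \<le> sqrt K"
    using \<open>0 < \<delta>\<close> \<open>0 \<le> K\<close> assms by auto
  then have C: "2 * M / sqrt \<delta> \<le> C" "8 / sqrt \<delta> \<le> C" "sqrt K \<le> C" "0 < C"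
    unfolding C_def by linarith+
  have "K \<le> C\<^sup>2"
    using power_mono[OF C(3) parts(3), of 2] \<open>0 \<le> K\<close> by simp
  note C_bounds = C(1,2) this[unfolded K_def]
  have "sup0 {sample_prob n d (mix_density d \<epsilon> \<mu>) (\<lambda>X. Psi1 n d \<alpha> X = 0) | \<epsilon> \<mu>.
               (\<epsilon>, \<mu>) \<in> F2_params d M \<and> \<epsilon> * L2_set \<mu> {..<d} \<ge> \<rho>} \<le> \<beta>" (is "sup0 ?S \<le> \<beta>")
    if "1 \<le> n" "1 \<le> d" "C * real d powr (1/4) / sqrt (real n) \<le> \<rho>" for n d \<rho>
  proof -
    have "p \<le> \<beta>" if "p \<in> ?S" for p
    proof -
      obtain \<epsilon> \<mu> where p: "p = sample_prob n d (mix_density d \<epsilon> \<mu>) (\<lambda>X. Psi1 n d \<alpha> X = 0)"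
        and "(\<epsilon>, \<mu>) \<in> F2_params d M" and sep: "\<rho> \<le> \<epsilon> * L2_set \<mu> {..<d}"
        using \<open>p \<in> ?S\<close> by blast
      then have "0 < \<epsilon>" "\<epsilon> < 1" "L2_set \<mu> {..<d} \<le> M"
        by (auto simp: F2_params_def)
      then have "p \<le> 3 * \<delta>"
        unfolding p
        using type_II_error_Psi1[OF assms(1,2) \<open>0 < \<delta>\<close> assms(5) \<open>1 \<le> n\<close> \<open>1 \<le> d\<close> _ _ _ _ C_bounds]
          order_trans[OF \<open>C * real d powr (1/4) / sqrt (real n) \<le> \<rho>\<close> sep] by blast
      then show ?thesis
        by (simp add: \<delta>_def)
    qed
    then show ?thesis
      using assms by (auto simp: sup0_def intro!: cSup_least)
  qed
  with \<open>0 < C\<close> show "\<exists>C>0. \<forall>n\<ge>1. \<forall>d\<ge>1. \<forall>\<rho>>0. \<rho> \<ge> C * real d powr (1/4) / sqrt (real n) \<longrightarrow>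
       sup0 {sample_prob n d (mix_density d \<epsilon> \<mu>) (\<lambda>X. Psi1 n d \<alpha> X = 0) | \<epsilon> \<mu>.
               (\<epsilon>, \<mu>) \<in> F2_params d M \<and> \<epsilon> * L2_set \<mu> {..<d} \<ge> \<rho>} \<le> \<beta>"
    by blast
qed

end
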